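(* Let $(C,e,\lambda,\oplus)$ be a Catalan structure, and let $\gamma$ and $\ominus$ be the derived secondary operations on $C$. Then the quadruple $(C,e,\gamma,\ominus)$ is itself a Catalan structure.
   Context: A Catalan structure is a quadruple $(C,e,\lambda,\oplus)$ where $C=\bigsqcup_{n\ge 0}C_n$ with $C_0=\{e\}$ ($|t|=n$ for $t\in C_n$), $\lambda\colon C_n\to C_{n+1}$, $\oplus\colon C_m\times C_n\to C_{m+n}$, $\oplus$ is associative with two-sided identity $e$, and every $t\in C$ can be written uniquely in exactly one of three forms: $t=e$; $t=\lambda(s)$ with $s\in C$ (indecomposable); $t=u\oplus v$ with $u$ indecomposable and $v\in C\setminus C_0$ (decomposable). Secondary operations: $\gamma(t)=t\oplus\lambda(e)$, and $\ominus$ is defined by recursion on the first argument by $e\ominus v=v$, $\lambda(u)\ominus v=\lambda(u\ominus v)$, $(t\oplus u)\ominus v=t\oplus(u\ominus v)$ for $t,u\ne e$ (this does not depend on the chosen factorization; one may take $t$ indecomposable). *)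

theory Defs
  imports Main "HOL-Library.Disjoint_Sets"
begin

text \<open>
  The data of a Catalan structure, before any axioms are imposed: \<open>C n\<close> is the set of elements
  of size \<open>n\<close>, \<open>lam\<close> stands for the unary operation usually written as a lambda. All operations
  are meaningful on \<open>carrier\<close> only; their values elsewhere are irrelevant.
\<close>

locale catalan_data =
  fixes C :: "nat \<Rightarrow> 'a set"
    and e :: 'a
    and lam :: "'a \<Rightarrow> 'a"
    and oplus :: "'a \<Rightarrow> 'a \<Rightarrow> 'a"  (infixl "\<oplus>" 65)
begin

definition carrier :: "'a set" where
  "carrier = (\<Union>n. C n)"

definition indecomposable :: "'a \<Rightarrow> bool" where
  "indecomposable t \<longleftrightarrow> (\<exists>s\<in>carrier. t = lam s)"

definition decomposable :: "'a \<Rightarrow> bool" where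
  "decomposable t \<longleftrightarrow> (\<exists>u v. indecomposable u \<and> v \<in> carrier - C 0 \<and> t = u \<oplus> v)"

definition gamma :: "'a \<Rightarrow> 'a" where
  "gamma t = t \<oplus> lam e"

text \<open>
  The recursion for the second derived operation runs over arbitrary factorizations, so it is
  introduced through its graph. For a Catalan structure the graph is a total function on the
  carrier, and \<open>ominus\<close> satisfies the recursion equations for every factorization; see
  \<open>ominus_e\<close>, \<open>ominus_lam\<close> and \<open>ominus_oplus\<close> below.
\<close>

inductive ominus_graph :: "'a \<Rightarrow> 'a \<Rightarrow> 'a \<Rightarrow> bool" where
  base: "v \<in> carrier \<Longrightarrow> ominus_graph e v v"
| lam: "u \<in> carrier \<Longrightarrow> ominus_graph u v w \<Longrightarrow> ominus_graph (lam u) v (lam w)"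
| oplus: "t \<in> carrier - {e} \<Longrightarrow> u \<in> carrier - {e} \<Longrightarrow> ominus_graph u v w
    \<Longrightarrow> ominus_graph (t \<oplus> u) v (t \<oplus> w)"

definition ominus :: "'a \<Rightarrow> 'a \<Rightarrow> 'a"  (infixl "\<ominus>" 65) where
  "t \<ominus> v = (THE w. ominus_graph t v w)"

end

locale catalan_structure = catalan_data +
  assumes disjoint: "disjoint_family C"
    and C_0: "C 0 = {e}"
    and lam_closed: "t \<in> C n \<Longrightarrow> lam t \<in> C (Suc n)"
    and oplus_closed: "t \<in> C m \<Longrightarrow> u \<in> C n \<Longrightarrow> t \<oplus> u \<in> C (m + n)"
    and oplus_assoc: "t \<in> carrier \<Longrightarrow> u \<in> carrier \<Longrightarrow> v \<in> carrier
          \<Longrightarrow> (t \<oplus> u) \<oplus> v = t \<oplus> (u \<oplus> v)"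
    and e_oplus: "t \<in> carrier \<Longrightarrow> e \<oplus> t = t"
    and oplus_e: "t \<in> carrier \<Longrightarrow> t \<oplus> e = t"
    and exactly_one_form: "t \<in> carrier \<Longrightarrow>
          (t = e \<and> \<not> indecomposable t \<and> \<not> decomposable t) \<or>
          (t \<noteq> e \<and> indecomposable t \<and> \<not> decomposable t) \<or>
          (t \<noteq> e \<and> \<not> indecomposable t \<and> decomposable t)"
    and lam_unique: "inj_on lam carrier"
    and oplus_unique: "indecomposable u \<Longrightarrow> indecomposable u' \<Longrightarrow>
          v \<in> carrier - C 0 \<Longrightarrow> v' \<in> carrier - C 0 \<Longrightarrow>
          u \<oplus> v = u' \<oplus> v' \<Longrightarrow> u = u' \<and> v = v'"
begin

lemma e_carrier: "e \<in> carrier"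
  using C_0 unfolding carrier_def by blast

lemma lam_carrier: "t \<in> carrier \<Longrightarrow> lam t \<in> carrier"
  using lam_closed unfolding carrier_def by blast

lemma oplus_carrier: "t \<in> carrier \<Longrightarrow> u \<in> carrier \<Longrightarrow> t \<oplus> u \<in> carrier"
  using oplus_closed unfolding carrier_def by blast

lemma indecomposable_carrier: "indecomposable t \<Longrightarrow> t \<in> carrier"
  using lam_carrier unfolding indecomposable_def by blast

lemma size_unique: "t \<in> C m \<Longrightarrow> t \<in> C n \<Longrightarrow> m = n"
  using disjoint unfolding disjoint_family_on_def by blast

lemma size_pos: "t \<in> C n \<Longrightarrow> t \<noteq> e \<Longrightarrow> n > 0"
  using C_0 by (cases n) auto

lemma indecomposable_not_e: "indecomposable t \<Longrightarrow> t \<noteq> e"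
  using exactly_one_form e_carrier by blast

lemma oplus_not_e:
  assumes "t \<in> carrier" "u \<in> carrier" "t \<noteq> e"
  shows "t \<oplus> u \<noteq> e"
proof
  assume eq: "t \<oplus> u = e"
  obtain m n where mn: "t \<in> C m" "u \<in> C n"
    using assms unfolding carrier_def by blast
  have "e \<in> C (m + n)" "e \<in> C 0"
    using oplus_closed[OF mn] eq C_0 by auto
  then have "m = 0" using size_unique by fastforce
  then show False using size_pos mn assms(3) by blast
qed

lemma form_cases [consumes 1, case_names e lam oplus]:
  assumes "t \<in> carrier"
  obtains "t = e"
    | s where "s \<in> carrier" "t = lam s"
    | u v where "indecomposable u" "v \<in> carrier" "v \<noteq> e" "t = u \<oplus> v"
  using exactly_one_form[OF assms] C_0
  unfolding decomposable_def indecomposable_def by auto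

lemma factor_head:
  assumes "t \<in> carrier" "t \<noteq> e" "u \<in> carrier" "u \<noteq> e"
  obtains "indecomposable t"
    | a b where "indecomposable a" "b \<in> carrier" "b \<noteq> e" "t = a \<oplus> b"
      "t \<oplus> u = a \<oplus> (b \<oplus> u)" "b \<oplus> u \<in> carrier" "b \<oplus> u \<noteq> e"
  using assms(1)
proof (cases t rule: form_cases)
  case e
  then show ?thesis using assms by simp
next
  case (lam s)
  then show ?thesis using that(1) unfolding indecomposable_def by blast
next
  case (oplus a b)
  then show ?thesis
    using that(2) oplus_assoc oplus_carrier oplus_not_e indecomposable_carrier assms by metis
qed

lemma lam_not_oplus:
  assumes "s \<in> carrier" "t \<in> carrier" "t \<noteq> e" "u \<in> carrier" "u \<noteq> e"
  shows "lam s \<noteq> t \<oplus> u"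
proof
  assume eq: "lam s = t \<oplus> u"
  have "decomposable (t \<oplus> u)"
    using assms(2-5)
  proof (cases rule: factor_head)
    case 1
    then show ?thesis using assms C_0 unfolding decomposable_def by auto
  next
    case (2 a b)
    then show ?thesis using C_0 unfolding decomposable_def by auto
  qed
  moreover have "indecomposable (t \<oplus> u)"
    using assms(1) eq unfolding indecomposable_def by metis
  ultimately show False using exactly_one_form assms oplus_carrier by blast
qed

lemma ominus_graph_carrier:
  "ominus_graph t v w \<Longrightarrow> t \<in> carrier \<and> v \<in> carrier \<and> w \<in> carrier"
  by (induction rule: ominus_graph.induct) (auto simp: e_carrier lam_carrier oplus_carrier)

lemma ominus_graph_e: "ominus_graph e v w \<Longrightarrow> w = v"
proof (erule ominus_graph.cases, goal_cases)
  case (2 u v' w')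
  then show ?case using indecomposable_not_e unfolding indecomposable_def by metis
next
  case (3 t u v' w')
  then show ?case using oplus_not_e by (metis DiffD1 DiffD2 singletonI)
qed simp

lemma ominus_graph_lam:
  assumes "ominus_graph (lam u) v w" "u \<in> carrier"
  shows "\<exists>w'. ominus_graph u v w' \<and> w = lam w'"
  using assms(1)
proof (cases rule: ominus_graph.cases)
  case base
  then show ?thesis using assms indecomposable_not_e unfolding indecomposable_def by metis
next
  case (lam u' w')
  then have "u' = u" using assms(2) lam_unique by (auto dest: inj_onD)
  then show ?thesis using lam by blast
next
  case (oplus t' u' w')
  then show ?thesis using lam_not_oplus assms(2) by blast
qed

lemma ominus_graph_oplus:
  assumes "ominus_graph (a \<oplus> b) v w" "indecomposable a" "b \<in> carrier" "b \<noteq> e"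
  shows "\<exists>w'. ominus_graph b v w' \<and> w = a \<oplus> w'"
  using assms(1)
proof (cases rule: ominus_graph.cases)
  case base
  then show ?thesis
    using assms oplus_not_e indecomposable_carrier indecomposable_not_e by metis
next
  case (lam u w')
  then show ?thesis
    using assms lam_not_oplus indecomposable_carrier indecomposable_not_e by metis
next
  case (oplus t u w')
  have tu: "t \<in> carrier" "t \<noteq> e" "u \<in> carrier" "u \<noteq> e" using oplus by auto
  have w': "w' \<in> carrier" using oplus ominus_graph_carrier by blast
  show ?thesis
    using tu
  proof (cases rule: factor_head)
    case 1
    then have "a = t \<and> b = u"
      using oplus_unique[of a t b u] assms tu oplus C_0 by auto
    then show ?thesis using oplus by blast
  next
    case (2 a' b')
    then have eq: "a = a' \<and> b = b' \<oplus> u"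
      using oplus_unique[of a a' b "b' \<oplus> u"] assms oplus C_0 by auto
    have "ominus_graph (b' \<oplus> u) v (b' \<oplus> w')"
      using 2 tu oplus by (intro ominus_graph.oplus) auto
    moreover have "w = a' \<oplus> (b' \<oplus> w')"
      using oplus 2 w' oplus_assoc indecomposable_carrier by metis
    ultimately show ?thesis using eq by blast
  qed
qed

lemma carrier_induct [consumes 1, case_names e lam oplus]:
  assumes "t \<in> carrier"
    and "P e"
    and "\<And>s. s \<in> carrier \<Longrightarrow> P s \<Longrightarrow> P (lam s)"
    and "\<And>u v. indecomposable u \<Longrightarrow> v \<in> carrier \<Longrightarrow> v \<noteq> e \<Longrightarrow> P v \<Longrightarrow> P (u \<oplus> v)"
  shows "P t"
proof -
  obtain n where "t \<in> C n" using assms(1) unfolding carrier_def by blast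
  then show ?thesis
  proof (induction n arbitrary: t rule: less_induct)
    case (less n)
    have "t \<in> carrier" using less.prems unfolding carrier_def by blast
    then show ?case
    proof (cases t rule: form_cases)
      case e
      then show ?thesis using assms(2) by simp
    next
      case (lam s)
      obtain k where k: "s \<in> C k" using lam unfolding carrier_def by blast
      then have "Suc k = n" using lam less.prems lam_closed size_unique by blast
      then have "P s" using less.IH k by blast
      then show ?thesis using assms(3) lam by blast
    next
      case (oplus u v)
      obtain k l where kl: "u \<in> C k" "v \<in> C l"
        using oplus indecomposable_carrier unfolding carrier_def by blast
      then have "k + l = n" using oplus less.prems oplus_closed size_unique by blast
      moreover have "k > 0" using size_pos kl oplus indecomposable_not_e by blast
      ultimately have "P v" using less.IH[of l] kl by simp
      then show ?thesis using assms(4) oplus by blast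
    qed
  qed
qed

lemma ominus_graph_ex1:
  assumes "t \<in> carrier" "v \<in> carrier"
  shows "\<exists>!w. ominus_graph t v w"
  using assms(1)
proof (induction t rule: carrier_induct)
  case e
  then show ?case using ominus_graph.base ominus_graph_e assms by blast
next
  case (lam s)
  then show ?case using ominus_graph.lam ominus_graph_lam by metis
next
  case (oplus a b)
  then have a: "a \<in> carrier - {e}"
    using indecomposable_carrier indecomposable_not_e by blast
  then show ?case
    using oplus ominus_graph.oplus[of a b] ominus_graph_oplus[of a b] by (metis DiffI singletonD)
qed

lemma ominus_graph_iff:
  assumes "t \<in> carrier" "v \<in> carrier"
  shows "ominus_graph t v w \<longleftrightarrow> t \<ominus> v = w"
  using theI'[OF ominus_graph_ex1[OF assms]] ominus_graph_ex1[OF assms]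
  unfolding ominus_def by blast

lemma ominus_e: "v \<in> carrier \<Longrightarrow> e \<ominus> v = v"
  using ominus_graph.base ominus_graph_iff e_carrier by blast

lemma ominus_lam: "u \<in> carrier \<Longrightarrow> v \<in> carrier \<Longrightarrow> lam u \<ominus> v = lam (u \<ominus> v)"
  using ominus_graph.lam ominus_graph_iff lam_carrier by metis

lemma ominus_oplus:
  assumes "t \<in> carrier" "t \<noteq> e" "u \<in> carrier" "u \<noteq> e" "v \<in> carrier"
  shows "(t \<oplus> u) \<ominus> v = t \<oplus> (u \<ominus> v)"
  using assms ominus_graph.oplus[of t u v "u \<ominus> v"] ominus_graph_iff oplus_carrier by auto

end

end

(* Picture the elements as plane forests: lam adds a root, oplus juxtaposes two forests, so gamma
   appends a one-vertex tree, and t ominus v grafts v below the last vertex of the rightmost path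
   of t. Every forest other than e has a unique last tree, i.e. is uniquely a oplus lam s, and
   a oplus lam s = gamma a ominus s. This is the unique factorization for gamma and ominus; it is
   indecomposable exactly when s = e. *)

theory Submission imports Defs begin

context catalan_structure
begin

lemma carrierI: "t \<in> C n \<Longrightarrow> t \<in> carrier"
  unfolding carrier_def by blast

lemma indecomposable_lam: "s \<in> carrier \<Longrightarrow> indecomposable (lam s)"
  unfolding indecomposable_def by blast

lemma oplus_lam_not_e:
  assumes "a \<in> carrier" "s \<in> carrier"
  shows "a \<oplus> lam s \<noteq> e"
  using assms oplus_not_e e_oplus lam_carrier indecomposable_lam indecomposable_not_e by metis

text \<open>Allowing \<open>v = e\<close> absorbs the case \<open>lam s\<close> as
  \<open>lam s \<oplus> e\<close>, so every element other than \<open>e\<close> has a first tree and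
  a possibly empty rest.\<close>

lemma carrier_head_cases [consumes 1, case_names e oplus]:
  assumes "t \<in> carrier"
  obtains "t = e"
    | u v where "indecomposable u" "v \<in> carrier" "t = u \<oplus> v"
  using assms
proof (cases t rule: form_cases)
  case (lam s)
  then have "t = lam s \<oplus> e" using oplus_e lam_carrier by simp
  then show ?thesis using that(2) lam indecomposable_lam e_carrier by blast
qed (use that in blast)+

text \<open>Extends \<open>oplus_unique\<close> to empty rests. If just one rest is empty, a single
  tree would equal a sum of two nonempty forests, against \<open>lam_not_oplus\<close>.\<close>

lemma oplus_head_unique:
  assumes "indecomposable u" "indecomposable u'" "v \<in> carrier" "v' \<in> carrier"
    and eq: "u \<oplus> v = u' \<oplus> v'"
  shows "u = u' \<and> v = v'"
proof -
  obtain s s' where s: "u = lam s" "s \<in> carrier" "u' = lam s'" "s' \<in> carrier"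
    using assms unfolding indecomposable_def by blast
  have u: "u \<in> carrier" "u \<noteq> e" "u' \<in> carrier" "u' \<noteq> e"
    using assms indecomposable_carrier indecomposable_not_e by auto
  consider "v = e" "v' = e" | "v = e" "v' \<noteq> e" | "v \<noteq> e" "v' = e" | "v \<noteq> e" "v' \<noteq> e"
    by blast
  then show ?thesis
  proof cases
    case 1
    then show ?thesis using eq u oplus_e by simp
  next
    case 2
    then show ?thesis using eq u s assms oplus_e lam_not_oplus[of s u' v'] by simp
  next
    case 3
    then show ?thesis using eq u s assms oplus_e lam_not_oplus[of s' u v] by simp
  next
    case 4
    then show ?thesis using oplus_unique[of u u' v v'] assms C_0 by auto
  qed
qed

text \<open>The axioms give uniqueness of the first tree; here it is carried over to the last one by
  stripping equal first trees from both sides until \<open>a\<close> is empty.\<close>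

lemma oplus_lam_unique:
  assumes "a \<in> carrier" "a' \<in> carrier" "s \<in> carrier" "s' \<in> carrier"
    and "a \<oplus> lam s = a' \<oplus> lam s'"
  shows "a = a' \<and> s = s'"
proof -
  \<comment> \<open>Stripping one tree. The claim for the rest \<open>v\<close> is a premise, since
    in the case \<open>a = lam r\<close> the rest is \<open>e\<close>, for which
    \<open>carrier_induct\<close> supplies no induction hypothesis; \<open>base\<close>
    does.\<close>
  have step: "u \<oplus> v = a' \<and> s = s'"
    if u: "indecomposable u" and v: "v \<in> carrier" and a': "a' \<in> carrier"
      and eq: "(u \<oplus> v) \<oplus> lam s = a' \<oplus> lam s'"
      and IH: "\<And>v'. v' \<in> carrier \<Longrightarrow> v \<oplus> lam s = v' \<oplus> lam s' \<Longrightarrow> v = v' \<and> s = s'"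
    for u v a'
  proof -
    have uc: "u \<in> carrier" "u \<noteq> e"
      using u indecomposable_carrier indecomposable_not_e by auto
    have eq': "u \<oplus> (v \<oplus> lam s) = a' \<oplus> lam s'"
      using eq oplus_assoc uc v lam_carrier assms(3) by simp
    have vs: "v \<oplus> lam s \<in> carrier" "v \<oplus> lam s \<noteq> e"
      using v assms(3) oplus_carrier lam_carrier oplus_lam_not_e by auto
    show ?thesis
      using a'
    proof (cases a' rule: carrier_head_cases)
      \<comment> \<open>With \<open>a' = e\<close> the right side is the single tree
        \<open>lam s'\<close>, while the left has at least two.\<close>
      case e
      then show ?thesis
        using eq' lam_not_oplus[OF assms(4) uc vs] e_oplus lam_carrier assms(4) by simp
    next
      case (oplus u' v')
      then have "u \<oplus> (v \<oplus> lam s) = u' \<oplus> (v' \<oplus> lam s')"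
        using eq' oplus_assoc indecomposable_carrier lam_carrier assms(4) by simp
      then have "u = u' \<and> v \<oplus> lam s = v' \<oplus> lam s'"
        using oplus_head_unique[of u u' "v \<oplus> lam s" "v' \<oplus> lam s'"]
          u vs oplus oplus_carrier lam_carrier assms(4) by simp
      then show ?thesis using IH[of v'] oplus by simp
    qed
  qed
  have base: "e = a' \<and> s = s'" if a': "a' \<in> carrier" and eq: "e \<oplus> lam s = a' \<oplus> lam s'" for a'
  proof -
    have eq': "lam s = a' \<oplus> lam s'" using eq e_oplus lam_carrier assms(3) by simp
    have ls': "lam s' \<in> carrier" "lam s' \<noteq> e"
      using assms(4) lam_carrier indecomposable_lam indecomposable_not_e by auto
    have "a' = e" using eq' lam_not_oplus[OF assms(3) a' _ ls'] by blast
    moreover from this have "s = s'"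
      using eq' e_oplus ls' lam_unique assms(3,4) by (auto dest: inj_onD)
    ultimately show ?thesis by simp
  qed
  show ?thesis
    using assms(1,2,5)
  proof (induction a arbitrary: a' rule: carrier_induct)
    case e
    then show ?case using base by blast
  next
    case (lam r)
    then show ?case
      using step[of "lam r" e a'] base oplus_e lam_carrier indecomposable_lam e_carrier by simp
  next
    case (oplus u v)
    then show ?case using step[of u v a'] by blast
  qed
qed

text \<open>Existence of the last tree: \<open>u \<oplus> v\<close> with \<open>v\<close> nonempty
  inherits it from \<open>v\<close>, and associativity moves \<open>u\<close> into the front
  part.\<close>

lemma oplus_lam_cases [consumes 1, case_names e oplus]:
  assumes "t \<in> carrier"
  obtains "t = e"
    | a s where "a \<in> carrier" "s \<in> carrier" "t = a \<oplus> lam s"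
proof -
  have "t = e \<or> (\<exists>a\<in>carrier. \<exists>s\<in>carrier. t = a \<oplus> lam s)"
    using assms
  proof (induction t rule: carrier_induct)
    case (lam s)
    then show ?case using e_oplus e_carrier lam_carrier by metis
  next
    case (oplus u v)
    then obtain a s where as: "a \<in> carrier" "s \<in> carrier" "v = a \<oplus> lam s" by blast
    then have "u \<oplus> v = (u \<oplus> a) \<oplus> lam s"
      using oplus_assoc oplus indecomposable_carrier lam_carrier by simp
    then show ?case using as oplus indecomposable_carrier oplus_carrier by blast
  qed simp
  then show ?thesis using that by blast
qed

lemma ominus_carrier: "t \<in> carrier \<Longrightarrow> v \<in> carrier \<Longrightarrow> t \<ominus> v \<in> carrier"
  using ominus_graph_iff ominus_graph_carrier by blast

lemma ominus_indecomposable_oplus: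
  assumes "indecomposable u" "t \<in> carrier" "t \<noteq> e" "v \<in> carrier"
  shows "(u \<oplus> t) \<ominus> v = u \<oplus> (t \<ominus> v)"
  using assms ominus_oplus indecomposable_carrier indecomposable_not_e by blast

lemma ominus_closed:
  assumes "t \<in> C m" "v \<in> C n"
  shows "t \<ominus> v \<in> C (m + n)"
proof -
  have v: "v \<in> carrier" using assms carrierI by blast
  have "t \<in> carrier" using assms carrierI by blast
  then show ?thesis
    using assms(1)
  proof (induction t arbitrary: m rule: carrier_induct)
    case e
    then have "m = 0" using C_0 size_unique by blast
    then show ?case using ominus_e v assms by simp
  next
    case (lam s)
    then obtain k where k: "s \<in> C k" unfolding carrier_def by blast
    then have "m = Suc k" using lam lam_closed size_unique by blast
    then show ?case using lam k v ominus_lam lam_closed by simp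
  next
    case (oplus a b)
    then obtain k l where kl: "a \<in> C k" "b \<in> C l"
      using indecomposable_carrier unfolding carrier_def by blast
    then have "m = k + l" using oplus oplus_closed size_unique by blast
    moreover have "a \<oplus> (b \<ominus> v) \<in> C (k + (l + n))"
      using oplus kl oplus_closed by blast
    ultimately show ?case
      using oplus v ominus_indecomposable_oplus by (simp add: add.assoc)
  qed
qed

text \<open>Sizes add, so only \<open>t\<close> of size 0 could yield \<open>e\<close>.
  Associativity needs this: the recursion for
  \<open>(a \<oplus> (b \<ominus> u)) \<ominus> v\<close> requires a nonempty second
  summand.\<close>

lemma ominus_not_e:
  assumes "t \<in> carrier" "t \<noteq> e" "v \<in> carrier"
  shows "t \<ominus> v \<noteq> e"
proof
  assume eq: "t \<ominus> v = e"
  obtain m n where mn: "t \<in> C m" "v \<in> C n" using assms unfolding carrier_def by blast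
  then have "e \<in> C (m + n)" using ominus_closed eq by metis
  then have "m + n = 0" using C_0 size_unique by blast
  then show False using size_pos mn assms by auto
qed

lemma ominus_right_e: "t \<in> carrier \<Longrightarrow> t \<ominus> e = t"
  by (induction t rule: carrier_induct)
    (simp_all add: ominus_e ominus_lam ominus_indecomposable_oplus e_carrier)

lemma ominus_assoc:
  assumes "t \<in> carrier" "u \<in> carrier" "v \<in> carrier"
  shows "(t \<ominus> u) \<ominus> v = t \<ominus> (u \<ominus> v)"
  using assms(1)
  by (induction t rule: carrier_induct)
    (simp_all add: assms ominus_e ominus_lam ominus_indecomposable_oplus ominus_carrier ominus_not_e)

text \<open>Translates factorizations for the new operations into last-tree factorizations: the
  recursion skips \<open>a\<close> and grafts \<open>s\<close> under the new vertex
  \<open>lam e\<close>. Empty \<open>a\<close> is separate because \<open>ominus_oplus\<close>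
  excludes it.\<close>

lemma gamma_ominus:
  assumes "a \<in> carrier" "s \<in> carrier"
  shows "gamma a \<ominus> s = a \<oplus> lam s"
proof -
  have le: "lam e \<ominus> s = lam s" using ominus_lam ominus_e e_carrier assms by simp
  show ?thesis
  proof (cases "a = e")
    case True
    then show ?thesis unfolding gamma_def using le e_oplus lam_carrier e_carrier assms by simp
  next
    case False
    then show ?thesis
      unfolding gamma_def
      using le assms ominus_oplus[of a "lam e" s] lam_carrier e_carrier
        indecomposable_lam[OF e_carrier] indecomposable_not_e by simp
  qed
qed

lemma catalan_structure_gamma_ominus: "catalan_structure C e gamma (\<ominus>)"
proof -
  \<comment> \<open>\<open>D\<close> provides the predicates of the new structure; the carrier
    depends on \<open>C\<close> alone and is shared.\<close>
  interpret D: catalan_data C e gamma "(\<ominus>)" .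
  have ind: "D.indecomposable t \<longleftrightarrow> (\<exists>a\<in>carrier. t = a \<oplus> lam e)" for t
    unfolding D.indecomposable_def gamma_def by blast
  \<comment> \<open>Compared with \<open>ind\<close>, only the condition on \<open>s\<close>
    changes, so for \<open>t = a \<oplus> lam s\<close> uniqueness of \<open>s\<close> makes the two
    forms exclusive.\<close>
  have dec: "D.decomposable t \<longleftrightarrow> (\<exists>a\<in>carrier. \<exists>s\<in>carrier - {e}. t = a \<oplus> lam s)" for t
    unfolding D.decomposable_def D.indecomposable_def C_0 using gamma_ominus by (metis DiffD1)
  show ?thesis
  proof
    show "gamma t \<in> C (Suc n)" if "t \<in> C n" for t n
      unfolding gamma_def using oplus_closed[OF that lam_closed[of e 0]] C_0 by simp
    show "(t = e \<and> \<not> D.indecomposable t \<and> \<not> D.decomposable t) \<or>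
        (t \<noteq> e \<and> D.indecomposable t \<and> \<not> D.decomposable t) \<or>
        (t \<noteq> e \<and> \<not> D.indecomposable t \<and> D.decomposable t)" if "t \<in> carrier" for t
      using that
    proof (cases t rule: oplus_lam_cases)
      case e
      then show ?thesis unfolding ind dec using oplus_lam_not_e e_carrier by (metis DiffD1)
    next
      case (oplus a s)
      have "t \<noteq> e" using oplus oplus_lam_not_e by simp
      moreover have "D.indecomposable t \<longleftrightarrow> s = e"
        unfolding ind using oplus oplus_lam_unique e_carrier by metis
      moreover have "D.decomposable t \<longleftrightarrow> s \<noteq> e"
        unfolding dec using oplus oplus_lam_unique by (metis DiffD1 DiffD2 DiffI singletonD singletonI)
      ultimately show ?thesis by blast
    qed
    show "inj_on gamma carrier"
      unfolding gamma_def using oplus_lam_unique e_carrier by (intro inj_onI) blast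
    \<comment> \<open>Writing \<open>u = gamma a\<close> and \<open>u' = gamma a'\<close> turns the
      equation into \<open>a \<oplus> lam v = a' \<oplus> lam v'\<close>.\<close>
    show "u = u' \<and> v = v'"
      if uu': "D.indecomposable u" "D.indecomposable u'" and vv': "v \<in> carrier - C 0" "v' \<in> carrier - C 0"
        and eq: "u \<ominus> v = u' \<ominus> v'" for u u' v v'
    proof -
      obtain a a' where "a \<in> carrier" "u = gamma a" "a' \<in> carrier" "u' = gamma a'"
        using uu' unfolding D.indecomposable_def by blast
      then show ?thesis using vv' eq gamma_ominus oplus_lam_unique[of a a' v v'] by simp
    qed
  qed (fact disjoint C_0 ominus_closed ominus_assoc ominus_e ominus_right_e)+
qed

end

theorem proposition2p4:
  fixes C :: "nat \<Rightarrow> 'a set"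
    and e :: 'a
    and lam :: "'a \<Rightarrow> 'a"
    and oplus :: "'a \<Rightarrow> 'a \<Rightarrow> 'a"
  assumes "catalan_structure C e lam oplus"
  shows "catalan_structure C e (catalan_data.gamma e lam oplus) (catalan_data.ominus C e lam oplus)"
  using assms by (rule catalan_structure.catalan_structure_gamma_ominus)

end
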